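(* Let $H$, $c$, $C=H-e_1c^T$, $p(x)=\nu_n\det(xI-C)$ be as in the context, let $C+\delta C=H+\delta H-(e_1+\delta e_1)(c+\delta c)^T$ with $\|\delta H\|_2\le\epsilon_H<1$, $\|\delta c\|_2\le\epsilon_c$, $\|\delta e_1\|_2\le\epsilon_1$, and let $p(x)+\delta p(x):=\nu_n\det(xI-C-\delta C)$. Then the following first order expansion in $\epsilon_H,\epsilon_c,\epsilon_1$ holds: $$\begin{aligned}(p+\delta p)(x)\doteq{}& p(x)+\nu_n\left[\det(xI-H-\delta H)-\det(xI-H)\right]\\&+\chi\,\delta c^T\Phi(x)+\nu_n\,c^T\operatorname{adj}(xI-H)\,\delta e_1\\&+\nu_n\,c^T\left[\operatorname{adj}(xI-H-\delta H)-\operatorname{adj}(xI-H)\right]e_1 .\end{aligned}$$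
   Context: Let $n\ge1$ and let $\phi_0,\dots,\phi_n$ be real polynomials with $\deg\phi_j=j$ and leading coefficients $\nu_j\neq0$. Put $\chi=\nu_n\nu_{n-1}^{-1}$ and $\Phi(x)=[\phi_{n-1}(x),\dots,\phi_1(x),\phi_0(x)]^T$. $H$ is the unique constant $n\times n$ matrix with $H\Phi(x)=x\Phi(x)-\chi^{-1}\phi_n(x)e_1$, so that $\phi_n(x)=\nu_n\det(xI-H)$. The vector $c$ has length $n$, $C=H-e_1c^T$ and $p(x)=\nu_n\det(xI-C)$ (equivalently $p=\phi_n+\chi c^T\Phi$, i.e. the factor $\chi^{-1}$ of the confederate matrix is absorbed in $c$). The perturbations $\delta H$ ($n\times n$ matrix), $\delta e_1,\delta c$ (vectors of length $n$) are real or complex. $\operatorname{adj}$ is the adjugate. The symbol $\doteq$ means equality up to second order terms: for fixed basis and fixed $c$, the two sides differ by a polynomial in $x$ whose coefficients are $O(\epsilon_H^2+\epsilon_1^2+\epsilon_c^2)$ as $\epsilon_H,\epsilon_1,\epsilon_c\to0$, uniformly over all perturbations satisfying the norm bounds. *)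

theory Defs
  imports
    Jordan_Normal_Form.Char_Poly
    "HOL-Analysis.L2_Norm"
begin

text \<open>Matrix and vector indices start at 0, so the first standard basis vector
  \<open>e\<^sub>1\<close> is \<open>unit_vec n 0\<close>. Vectors with entries in \<open>\<complex>[x]\<close> stand for vectors depending
  polynomially on \<open>x\<close>; likewise \<open>char_poly_matrix A\<close> is \<open>xI - A\<close>.\<close>

abbreviation const_vec :: "complex vec \<Rightarrow> complex poly vec" where
  "const_vec \<equiv> map_vec (\<lambda>a. [:a:])"

abbreviation const_mat :: "complex mat \<Rightarrow> complex poly mat" where
  "const_mat \<equiv> map_mat (\<lambda>a. [:a:])"

definition basis_vec :: "(nat \<Rightarrow> real poly) \<Rightarrow> nat \<Rightarrow> complex poly vec" where
  "basis_vec \<phi> n = vec n (\<lambda>i. map_poly complex_of_real (\<phi> (n - 1 - i)))"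

text \<open>The product \<open>u v\<^sup>T\<close>, with no complex conjugation (as in \<open>\<bullet>\<close>).\<close>

definition outer_prod :: "complex vec \<Rightarrow> complex vec \<Rightarrow> complex mat" where
  "outer_prod u v = mat (dim_vec u) (dim_vec v) (\<lambda>(i, j). u $ i * v $ j)"

definition vec_norm2 :: "complex vec \<Rightarrow> real" where
  "vec_norm2 v = L2_set (\<lambda>i. cmod (v $ i)) {..<dim_vec v}"

definition mat_norm2 :: "complex mat \<Rightarrow> real" where
  "mat_norm2 A = (SUP v \<in> {v \<in> carrier_vec (dim_col A). vec_norm2 v \<le> 1}. vec_norm2 (A *\<^sub>v v))"

end

theory Submission
  imports Defs
begin

text \<open>By the matrix determinant lemma \<open>det (M + u v\<^sup>T) = det M + v\<^sup>T adj M u\<close>, with \<open>N = xI - H\<close> and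
  \<open>M = xI - H - \<delta>H\<close>,
  \<open>p + \<delta>p = \<nu>\<^sub>n (det M + (c + \<delta>c)\<^sup>T adj M (e\<^sub>1 + \<delta>e\<^sub>1))\<close> and \<open>p = \<nu>\<^sub>n (det N + c\<^sup>T adj N e\<^sub>1)\<close>.
  Since \<open>\<nu>\<^sub>n adj N e\<^sub>1 = \<chi> \<Phi>\<close>, the error of the first order expansion is exactly
  \<open>\<nu>\<^sub>n (\<delta>c\<^sup>T (adj M - adj N) e\<^sub>1 + c\<^sup>T (adj M - adj N) \<delta>e\<^sub>1 + \<delta>c\<^sup>T adj M \<delta>e\<^sub>1)\<close>.
  The adjugate is Lipschitz on bounded sets for the submultiplicative norm on polynomials given by the
  sum of the absolute values of the coefficients, so each of the three terms is of second order.\<close>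

section \<open>The coefficient sum norm on polynomials\<close>

text \<open>Summing over the list \<open>coeffs\<close> makes the norm recurse along
  \<open>pCons\<close>, so its basic properties follow by induction on the polynomial.\<close>

definition poly_l1 :: "'a :: real_normed_field poly \<Rightarrow> real" where
  "poly_l1 p = (\<Sum>a\<leftarrow>coeffs p. norm a)"

lemma poly_l1_0 [simp]: "poly_l1 0 = 0"
  by (simp add: poly_l1_def)

lemma poly_l1_pCons [simp]: "poly_l1 (pCons a p) = norm a + poly_l1 p"
  \<comment> \<open>\<open>pCons 0 0\<close> is the zero polynomial, the only case in which the
    coefficient list does not grow; both sides are then 0.\<close>
  by (cases "p = 0 \<and> a = 0") (auto simp: poly_l1_def coeffs_pCons_eq_cCons cCons_def)

lemma poly_l1_1 [simp]: "poly_l1 1 = 1"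
  by (simp add: one_pCons)

lemma poly_l1_nonneg [simp]: "0 \<le> poly_l1 p"
  by (induction p) auto

text \<open>This turns the final norm estimate back into the bound on single coefficients that the
  theorem asks for.\<close>

lemma norm_coeff_le_poly_l1: "norm (coeff p k) \<le> poly_l1 p"
proof (induction p arbitrary: k)
  case (pCons a p)
  have "norm (coeff p (k - 1)) \<le> norm a + poly_l1 p"
    by (rule order_trans[OF pCons.IH]) simp
  then show ?case by (cases k) auto
qed simp

lemma poly_l1_minus [simp]: "poly_l1 (- p) = poly_l1 p"
  by (induction p) auto

lemma poly_l1_smult [simp]: "poly_l1 (Polynomial.smult a p) = norm a * poly_l1 p"
  by (induction p) (auto simp: norm_mult algebra_simps)

lemma poly_l1_triangle: "poly_l1 (p + q) \<le> poly_l1 p + poly_l1 q"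
proof (induction p arbitrary: q)
  case (pCons a p)
  obtain b r where "q = pCons b r" by (cases q)
  then show ?case
    using pCons.IH[of r] norm_triangle_ineq[of a b] by auto
qed simp

lemma poly_l1_sum: "poly_l1 (sum f S) \<le> (\<Sum>i\<in>S. poly_l1 (f i))"
proof (induction S rule: infinite_finite_induct)
  case (insert x S)
  then show ?case using poly_l1_triangle[of "f x" "sum f S"] by simp
qed auto

lemma poly_l1_mult: "poly_l1 (p * q) \<le> poly_l1 p * poly_l1 q"
proof (induction p)
  case (pCons a p)
  show ?case
    \<comment> \<open>The product splits as \<open>smult a q + pCons 0 (p * q)\<close>, and the
      shift by \<open>pCons 0\<close> preserves the norm.\<close>
    using poly_l1_triangle[of "Polynomial.smult a q" "pCons 0 (p * q)"] pCons.IH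
    by (simp add: algebra_simps)
qed simp

lemma poly_l1_prod: "poly_l1 (prod f S) \<le> (\<Prod>i\<in>S. poly_l1 (f i))"
proof (induction S rule: infinite_finite_induct)
  case (insert x S)
  then show ?case
    using poly_l1_mult[of "f x" "prod f S"]
    by (simp add: order_trans mult_left_mono)
qed auto

section \<open>Lipschitz estimates for products, determinants and adjugates\<close>

text \<open>The factors are exchanged one at a time. Each exchange costs \<open>e\<close> times the
  other factors, all bounded by \<open>b\<close>; \<open>1 \<le> b\<close> allows the power of
  \<open>b\<close> to be rounded up to \<open>card S\<close>.\<close>

lemma poly_l1_prod_diff:
  fixes b e :: real
  assumes "finite S" and b: "1 \<le> b"
    and "\<And>i. i \<in> S \<Longrightarrow> poly_l1 (f i) \<le> b"
    and "\<And>i. i \<in> S \<Longrightarrow> poly_l1 (g i) \<le> b"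
    and "\<And>i. i \<in> S \<Longrightarrow> poly_l1 (f i - g i) \<le> e"
  shows "poly_l1 (prod f S - prod g S) \<le> card S * b ^ card S * e"
  using assms(1,3-)
proof (induction S)
  case (insert x S)
  \<comment> \<open>The inserted element makes the set nonempty, so the bound on the differences
    forces \<open>e\<close> to be nonnegative.\<close>
  have e: "0 \<le> e"
    using order_trans[OF poly_l1_nonneg insert.prems(3)[of x]] by simp
  have pf: "poly_l1 (prod f S) \<le> b ^ card S"
    using order_trans[OF poly_l1_prod prod_mono[of S "\<lambda>i. poly_l1 (f i)" "\<lambda>_. b"]]
      insert.prems(1) by simp
  have IH: "poly_l1 (prod f S - prod g S) \<le> card S * b ^ card S * e"
    by (rule insert.IH) (use insert.prems in auto)
  have "prod f (insert x S) - prod g (insert x S)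
      = (f x - g x) * prod f S + g x * (prod f S - prod g S)"
    using insert.hyps by (simp add: algebra_simps)
  then have "poly_l1 (prod f (insert x S) - prod g (insert x S))
      \<le> poly_l1 (f x - g x) * poly_l1 (prod f S) + poly_l1 (g x) * poly_l1 (prod f S - prod g S)"
    by (simp only:) (intro order_trans[OF poly_l1_triangle] add_mono poly_l1_mult)
  also have "\<dots> \<le> e * b ^ card S + b * (card S * b ^ card S * e)"
    using e b by (intro add_mono mult_mono insert.prems pf IH) auto
  also have "\<dots> \<le> e * b ^ Suc (card S) + b * (card S * b ^ card S * e)"
    using b e by (intro add_right_mono mult_left_mono power_increasing) auto
  also have "\<dots> = card (insert x S) * b ^ card (insert x S) * e"
    using insert.hyps by (simp add: algebra_simps)
  finally show ?case .
qed simp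

lemma poly_l1_signof_mult [simp]: "poly_l1 (signof \<pi> * p) = poly_l1 p"
  by (simp add: sign_def)

text \<open>By the Leibniz formula each of the \<open>fact m\<close> permutations contributes a
  signed difference of two products of \<open>m\<close> entries, and the sign does not affect the
  norm.\<close>

lemma poly_l1_det_diff:
  fixes A B :: "'a :: real_normed_field poly mat" and b e :: real
  assumes A: "A \<in> carrier_mat m m" and B: "B \<in> carrier_mat m m" and b: "1 \<le> b"
    and bA: "\<And>i j. i < m \<Longrightarrow> j < m \<Longrightarrow> poly_l1 (A $$ (i, j)) \<le> b"
    and bB: "\<And>i j. i < m \<Longrightarrow> j < m \<Longrightarrow> poly_l1 (B $$ (i, j)) \<le> b"
    and e: "\<And>i j. i < m \<Longrightarrow> j < m \<Longrightarrow> poly_l1 (A $$ (i, j) - B $$ (i, j)) \<le> e"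
  shows "poly_l1 (det A - det B) \<le> fact m * (m * b ^ m * e)"
proof -
  let ?P = "{p. p permutes {0..<m}}"
  have "det A - det B
      = (\<Sum>p\<in>?P. signof p * ((\<Prod>i=0..<m. A $$ (i, p i)) - (\<Prod>i=0..<m. B $$ (i, p i))))"
    by (simp add: det_def'[OF A] det_def'[OF B] sum_subtractf algebra_simps)
  then have "poly_l1 (det A - det B)
      \<le> (\<Sum>p\<in>?P. poly_l1 ((\<Prod>i=0..<m. A $$ (i, p i)) - (\<Prod>i=0..<m. B $$ (i, p i))))"
    by (metis (no_types, lifting) poly_l1_sum poly_l1_signof_mult sum.cong)
  also have "\<dots> \<le> (\<Sum>p\<in>?P. m * b ^ m * e)"
  proof (rule sum_mono)
    fix p assume "p \<in> ?P"
    then have p: "p i < m" if "i < m" for i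
      using that permutes_in_image[of p "{0..<m}" i] by simp
    show "poly_l1 ((\<Prod>i=0..<m. A $$ (i, p i)) - (\<Prod>i=0..<m. B $$ (i, p i))) \<le> m * b ^ m * e"
      using poly_l1_prod_diff[of "{0..<m}" b "\<lambda>i. A $$ (i, p i)" "\<lambda>i. B $$ (i, p i)" e]
        b bA[OF _ p] bB[OF _ p] e[OF _ p] by simp
  qed
  also have "\<dots> = fact m * (m * b ^ m * e)"
    by (simp add: card_permutations)
  finally show ?thesis .
qed

text \<open>Each entry is, up to a common sign, a difference of two minors of size
  \<open>n - 1\<close>, whose entries are among those of \<open>A\<close> and
  \<open>B\<close>.\<close>

lemma poly_l1_adj_mat_diff:
  fixes A B :: "'a :: real_normed_field poly mat" and b e :: real
  assumes A: "A \<in> carrier_mat n n" and B: "B \<in> carrier_mat n n" and b: "1 \<le> b"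
    and bA: "\<And>i j. i < n \<Longrightarrow> j < n \<Longrightarrow> poly_l1 (A $$ (i, j)) \<le> b"
    and bB: "\<And>i j. i < n \<Longrightarrow> j < n \<Longrightarrow> poly_l1 (B $$ (i, j)) \<le> b"
    and e: "\<And>i j. i < n \<Longrightarrow> j < n \<Longrightarrow> poly_l1 (A $$ (i, j) - B $$ (i, j)) \<le> e"
    and ij: "i < n" "j < n"
  shows "poly_l1 ((adj_mat A - adj_mat B) $$ (i, j))
    \<le> fact (n - 1) * (real (n - 1) * b ^ (n - 1) * e)"
proof -
  have sgn: "poly_l1 ((-1) ^ k * p) = poly_l1 p" for k and p :: "'a poly"
    by (cases "even k") auto
  have "(adj_mat A - adj_mat B) $$ (i, j)
      = (-1) ^ (j + i) * (det (mat_delete A j i) - det (mat_delete B j i))"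
    using A B ij by (simp add: adj_mat_def cofactor_def algebra_simps)
  moreover have "poly_l1 (det (mat_delete A j i) - det (mat_delete B j i))
      \<le> fact (n - 1) * (real (n - 1) * b ^ (n - 1) * e)"
    by (rule poly_l1_det_diff)
      (use A B b bA bB e in \<open>auto simp: mat_delete_def\<close>)
  ultimately show ?thesis by (simp add: sgn)
qed

text \<open>Multiplying by the adjugate takes the place of inverting \<open>A\<close>, which is not
  possible for the polynomial matrix xI - H to which this is applied below.\<close>

lemma adj_mat_mult_eq_smult:
  fixes A :: "'a :: comm_ring_1 mat"
  assumes A: "A \<in> carrier_mat n n" and x: "x \<in> carrier_vec n" and b: "b \<in> carrier_vec n"
    and Ax: "A *\<^sub>v x = r \<cdot>\<^sub>v b"
  shows "det A \<cdot>\<^sub>v x = r \<cdot>\<^sub>v (adj_mat A *\<^sub>v b)"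
proof -
  note adj = adj_mat[OF A]
  have "r \<cdot>\<^sub>v (adj_mat A *\<^sub>v b) = adj_mat A *\<^sub>v (A *\<^sub>v x)"
    unfolding Ax using adj(1) b by (intro eq_vecI) auto
  also have "\<dots> = (adj_mat A * A) *\<^sub>v x"
    by (rule assoc_mult_mat_vec[symmetric, OF adj(1) A x])
  also have "\<dots> = det A \<cdot>\<^sub>v x"
    unfolding adj(3) using x by auto
  finally show ?thesis by simp
qed

section \<open>Entrywise consequences of the norm bounds\<close>

lemma norm_vec_index_le_vec_norm2: "i < dim_vec v \<Longrightarrow> cmod (v $ i) \<le> vec_norm2 v"
  unfolding vec_norm2_def by (rule member_le_L2_set) auto

text \<open>An entry is a coordinate of the image of a unit vector, and unit vectors lie in the set
  over which the supremum is taken.\<close>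

lemma norm_mat_index_le_mat_norm2:
  assumes A: "A \<in> carrier_mat m n" and i: "i < m" and j: "j < n"
  shows "cmod (A $$ (i, j)) \<le> mat_norm2 A"
proof -
  let ?S = "{v \<in> carrier_vec (dim_col A). vec_norm2 v \<le> 1}"
  \<comment> \<open>A crude bound independent of \<open>v\<close>: the supremum is known to be an
    upper bound only once the set of values is bounded above.\<close>
  have le: "vec_norm2 (A *\<^sub>v v) \<le> (\<Sum>k<m. \<Sum>l<n. cmod (A $$ (k, l)))" if "v \<in> ?S" for v
  proof -
    have v: "cmod (v $ l) \<le> 1" if "l < n" for l
      using norm_vec_index_le_vec_norm2[of l v] \<open>v \<in> ?S\<close> A that by auto
    have "vec_norm2 (A *\<^sub>v v) \<le> (\<Sum>k<m. cmod ((A *\<^sub>v v) $ k))"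
      unfolding vec_norm2_def using A by (auto intro!: order_trans[OF L2_set_le_sum])
    also have "\<dots> \<le> (\<Sum>k<m. \<Sum>l<n. cmod (A $$ (k, l)))"
    proof (rule sum_mono)
      fix k assume k: "k \<in> {..<m}"
      have "(A *\<^sub>v v) $ k = (\<Sum>l<n. A $$ (k, l) * v $ l)"
        using A k \<open>v \<in> ?S\<close> by (auto simp: scalar_prod_def lessThan_atLeast0 intro!: sum.cong)
      also have "cmod \<dots> \<le> (\<Sum>l<n. cmod (A $$ (k, l)))"
        by (rule sum_norm_le) (use v in \<open>auto simp: norm_mult mult_left_le\<close>)
      finally show "cmod ((A *\<^sub>v v) $ k) \<le> (\<Sum>l<n. cmod (A $$ (k, l)))" .
    qed
    finally show ?thesis .
  qed
  have "unit_vec n j \<in> ?S"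
  proof -
    have "vec_norm2 (unit_vec n j) \<le> (\<Sum>k<n. cmod (unit_vec n j $ k))"
      unfolding vec_norm2_def by (auto intro!: order_trans[OF L2_set_le_sum])
    also have "\<dots> = (\<Sum>k<n. if k = j then 1 else 0)"
      by (intro sum.cong) (auto simp: unit_vec_def)
    finally show ?thesis using A j by simp
  qed
  then have "vec_norm2 (A *\<^sub>v unit_vec n j) \<le> mat_norm2 A"
    unfolding mat_norm2_def using le by (intro cSUP_upper bdd_aboveI2) auto
  moreover have "A $$ (i, j) = (A *\<^sub>v unit_vec n j) $ i"
    using A i j by simp
  ultimately show ?thesis
    using norm_vec_index_le_vec_norm2[of i "A *\<^sub>v unit_vec n j"] A i by simp
qed

text \<open>The double sum has n squared terms, each a polynomial entry scaled by two complex
  numbers. All three error terms of the theorem are estimated in this way.\<close>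

lemma poly_l1_bilinear_le:
  fixes u w :: "complex vec"
  assumes u: "u \<in> carrier_vec n" and w: "w \<in> carrier_vec n" and A: "A \<in> carrier_mat n n"
    and bu: "\<And>i. i < n \<Longrightarrow> cmod (u $ i) \<le> a" and bw: "\<And>i. i < n \<Longrightarrow> cmod (w $ i) \<le> d"
    and bA: "\<And>i j. i < n \<Longrightarrow> j < n \<Longrightarrow> poly_l1 (A $$ (i, j)) \<le> b"
  shows "poly_l1 (const_vec u \<bullet> (A *\<^sub>v const_vec w)) \<le> (real n)\<^sup>2 * (a * b * d)"
proof -
  have "const_vec u \<bullet> (A *\<^sub>v const_vec w)
      = (\<Sum>i<n. \<Sum>j<n. Polynomial.smult (u $ i * w $ j) (A $$ (i, j)))"
    using u w A
    by (auto simp: scalar_prod_def lessThan_atLeast0 smult_sum2 mult.commute intro!: sum.cong)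
  also have "poly_l1 \<dots> \<le> (\<Sum>i<n. \<Sum>j<n. poly_l1 (Polynomial.smult (u $ i * w $ j) (A $$ (i, j))))"
    by (intro order_trans[OF poly_l1_sum] sum_mono) auto
  also have "\<dots> \<le> (\<Sum>i<n. \<Sum>j<n. a * b * d)"
  proof (intro sum_mono)
    fix i j assume "i \<in> {..<n}" "j \<in> {..<n}"
    \<comment> \<open>The entry bounds themselves force \<open>a\<close> and \<open>d\<close> to be
      nonnegative, as the monotonicity of products requires.\<close>
    then have "cmod (u $ i) * cmod (w $ j) * poly_l1 (A $$ (i, j)) \<le> a * d * b"
      using order_trans[OF norm_ge_zero bu[of i]] order_trans[OF norm_ge_zero bw[of j]]
      by (intro mult_mono bu bw bA mult_nonneg_nonneg) auto
    then show "poly_l1 (Polynomial.smult (u $ i * w $ j) (A $$ (i, j))) \<le> a * b * d"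
      by (simp add: norm_mult mult_ac)
  qed
  also have "\<dots> = (real n)\<^sup>2 * (a * b * d)"
    by (simp add: power2_eq_square)
  finally show ?thesis .
qed

section \<open>Rank one updates of determinants and characteristic polynomials\<close>

text \<open>Clear the bordered matrix \<open>B = [[M, -u], [v\<^sup>T, 1]]\<close> in two ways by multiplying from the left: with
  \<open>[[I, u], [0, 1]]\<close> it becomes block lower triangular with corner \<open>M + u v\<^sup>T\<close>, and with
  \<open>[[I, 0], [v\<^sup>T adj M, -det M]]\<close> block upper triangular with corners \<open>M\<close> and
  \<open>-(det M + v\<^sup>T adj M u)\<close>.\<close>

lemma det_rank_one_update:
  fixes M :: "'a :: idom mat"
  assumes M: "M \<in> carrier_mat n n" and u: "u \<in> carrier_vec n" and v: "v \<in> carrier_vec n"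
    and nz: "det M \<noteq> 0"
  shows "det (M + mat n n (\<lambda>(i, j). u $ i * v $ j)) = det M + v \<bullet> (adj_mat M *\<^sub>v u)"
proof -
  define U where "U = mat n 1 (\<lambda>(i, j). u $ i)"
  define V where "V = mat 1 n (\<lambda>(i, j). v $ j)"
  define B where "B = four_block_mat M (- U) V (1\<^sub>m 1)"
  define d where "d = det M"
  define s where "s = v \<bullet> (adj_mat M *\<^sub>v u)"
  note adj = adj_mat[OF M]
  have U: "U \<in> carrier_mat n 1" "- U \<in> carrier_mat n 1" and V: "V \<in> carrier_mat 1 n"
    by (auto simp: U_def V_def)
  have VA: "V * adj_mat M \<in> carrier_mat 1 n" using V adj by simp
  have B: "B \<in> carrier_mat (n + 1) (n + 1)"
    unfolding B_def by (rule four_block_carrier_mat[OF M]) simp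
  have UV: "U * V = mat n n (\<lambda>(i, j). u $ i * v $ j)"
    by (rule eq_matI) (auto simp: U_def V_def scalar_prod_def)
  have VAU: "V * adj_mat M * U = mat 1 1 (\<lambda>_. s)"
  proof -
    have rc: "row V 0 = v" "col U 0 = u"
      using u v by (auto simp: U_def V_def)
    have "V * adj_mat M * U = V * (adj_mat M * U)"
      by (rule assoc_mult_mat[OF V adj(1) U(1)])
    also have "\<dots> = mat 1 1 (\<lambda>_. s)"
      using U V rc col_mult2[OF adj(1) U(1), of 0] by (intro eq_matI) (auto simp: s_def)
    finally show ?thesis .
  qed
  have "det B = det (M + U * V)"
  proof -
    let ?L = "four_block_mat (1\<^sub>m n) U (0\<^sub>m 1 n) (1\<^sub>m 1)"
    have L: "?L \<in> carrier_mat (n + 1) (n + 1)"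
      by (rule four_block_carrier_mat) auto
    have neg0: "- 0\<^sub>m (Suc 0) (Suc 0) = (0\<^sub>m (Suc 0) (Suc 0) :: 'a mat)"
      by (rule eq_matI) auto
    have "?L * B = four_block_mat (1\<^sub>m n * M + U * V) (1\<^sub>m n * - U + U * 1\<^sub>m 1)
        (0\<^sub>m 1 n * M + 1\<^sub>m 1 * V) (0\<^sub>m 1 n * - U + 1\<^sub>m 1 * 1\<^sub>m 1)"
      unfolding B_def by (rule mult_four_block_mat) (use M U V in auto)
    also have "\<dots> = four_block_mat (M + U * V) (0\<^sub>m n 1) V (1\<^sub>m 1)"
      using M U V neg0 by simp
    finally have "det ?L * det B = det (M + U * V) * det (1\<^sub>m 1)"
      using det_mult[OF L B] det_four_block_mat_upper_right_zero[OF _ refl V, of "M + U * V" "1\<^sub>m 1"] U V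
      by simp
    moreover have "det ?L = 1"
      using det_four_block_mat_lower_left_zero[OF one_carrier_mat U(1) refl one_carrier_mat] by simp
    ultimately show ?thesis by simp
  qed
  \<comment> \<open>The corner \<open>- d\<close> that clears the lower left block gives the
    multiplier determinant \<open>- d\<close>. Hence \<open>det B\<close> is determined only after
    cancelling \<open>d\<close>, which is where \<open>det M \<noteq> 0\<close> enters.\<close>
  moreover have "d * det B = d * (d + s)"
  proof -
    let ?R = "four_block_mat (1\<^sub>m n) (0\<^sub>m n 1) (V * adj_mat M) (- d \<cdot>\<^sub>m 1\<^sub>m 1)"
    let ?D = "mat 1 1 (\<lambda>_. - (d + s))"
    have R: "?R \<in> carrier_mat (n + 1) (n + 1)"
      by (rule four_block_carrier_mat) auto
    have "V * adj_mat M * M = V * (d \<cdot>\<^sub>m 1\<^sub>m n)"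
      unfolding d_def adj(3)[symmetric] by (rule assoc_mult_mat[OF V adj(1) M])
    then have VAM: "V * adj_mat M * M = d \<cdot>\<^sub>m V"
      using V by (simp add: mult_smult_distrib[OF V one_carrier_mat])
    have "?R * B = four_block_mat (1\<^sub>m n * M + 0\<^sub>m n 1 * V) (1\<^sub>m n * - U + 0\<^sub>m n 1 * 1\<^sub>m 1)
        (V * adj_mat M * M + (- d \<cdot>\<^sub>m 1\<^sub>m 1) * V) (V * adj_mat M * - U + (- d \<cdot>\<^sub>m 1\<^sub>m 1) * 1\<^sub>m 1)"
      unfolding B_def by (rule mult_four_block_mat) (use M U V VA in auto)
    also have "V * adj_mat M * M + (- d \<cdot>\<^sub>m 1\<^sub>m 1) * V = 0\<^sub>m 1 n"
      unfolding VAM using V by (intro eq_matI) auto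
    also have "V * adj_mat M * - U + (- d \<cdot>\<^sub>m 1\<^sub>m 1) * 1\<^sub>m 1 = - mat 1 1 (\<lambda>_. s) + - d \<cdot>\<^sub>m 1\<^sub>m 1"
      using U V VA adj(1) by (simp add: VAU uminus_mult_right_mat)
    also have "\<dots> = ?D" by (intro eq_matI) auto
    also have "1\<^sub>m n * M + 0\<^sub>m n 1 * V = M" using M V by simp
    finally have "det ?R * det B = det M * det ?D"
      using det_mult[OF R B] det_four_block_mat_lower_left_zero[OF M _ refl, of _ 1 ?D] U by simp
    moreover have "det ?R = - d"
      using det_four_block_mat_upper_right_zero[OF one_carrier_mat refl VA, of "- d \<cdot>\<^sub>m 1\<^sub>m 1"] by simp
    moreover have "det ?D = - (d + s)"
      by (subst det_single) auto
    ultimately have "- d * det B = d * - (d + s)" by (simp only: d_def)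
    then show ?thesis by (simp only: mult_minus_left mult_minus_right neg_equal_iff_equal)
  qed
  ultimately show ?thesis using nz by (simp add: d_def s_def UV)
qed

text \<open>Subtracting the outer product from \<open>A\<close> adds it to xI - A. The determinant
  of xI - A is monic, hence nonzero, so the rank one update formula applies.\<close>

lemma char_poly_diff_outer_prod:
  assumes A: "A \<in> carrier_mat n n" and u: "u \<in> carrier_vec n" and v: "v \<in> carrier_vec n"
  shows "char_poly (A - outer_prod u v)
    = char_poly A + const_vec v \<bullet> (adj_mat (char_poly_matrix A) *\<^sub>v const_vec u)"
proof -
  let ?M = "char_poly_matrix A"
  have "char_poly_matrix (A - outer_prod u v)
      = ?M + mat n n (\<lambda>(i, j). const_vec u $ i * const_vec v $ j)"
    using A u v by (intro eq_matI) (auto simp: char_poly_matrix_def outer_prod_def)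
  moreover have "det ?M \<noteq> 0"
    using degree_monic_char_poly[OF A] by (auto simp: char_poly_def)
  ultimately show ?thesis
    unfolding char_poly_def using A u v by (simp add: det_rank_one_update)
qed

section \<open>The first adjugate column of the confederate matrix\<close>

text \<open>The hypothesis on \<open>H\<close> says \<open>\<chi> (xI - H) \<Phi> = \<phi>\<^sub>n e\<^sub>1\<close>; multiplying by the adjugate gives
  \<open>\<chi> det (xI - H) \<Phi> = \<phi>\<^sub>n adj (xI - H) e\<^sub>1\<close>. The last entry of \<open>\<Phi>\<close> is a nonzero constant, so
  comparing degrees there shows that \<open>\<phi>\<^sub>n\<close> is a constant multiple of \<open>det (xI - H)\<close>.\<close>

lemma confederate_adj_first_column:
  fixes \<phi> :: "nat \<Rightarrow> real poly" and \<chi> :: real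
  assumes n: "n \<ge> 1"
    and deg: "\<And>j. j \<le> n \<Longrightarrow> degree (\<phi> j) = j"
    and nz: "\<phi> 0 \<noteq> 0" and chi: "\<chi> \<noteq> 0"
    and H_dim: "H \<in> carrier_mat n n"
    and H: "const_mat H *\<^sub>v basis_vec \<phi> n =
      [:0, 1:] \<cdot>\<^sub>v basis_vec \<phi> n
      - Polynomial.smult (inverse (of_real \<chi>)) (map_poly of_real (\<phi> n)) \<cdot>\<^sub>v const_vec (unit_vec n 0)"
  shows "[:of_real (lead_coeff (\<phi> n)):] \<cdot>\<^sub>v (adj_mat (char_poly_matrix H) *\<^sub>v const_vec (unit_vec n 0))
    = [:of_real \<chi>:] \<cdot>\<^sub>v basis_vec \<phi> n"
proof -
  define \<Phi> where "\<Phi> = basis_vec \<phi> n"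
  define N where "N = char_poly_matrix H"
  define f where "f = map_poly complex_of_real (\<phi> n)"
  define e where "e = const_vec (unit_vec n 0)"
  define a where "a = adj_mat N *\<^sub>v e"
  define d where "d = det N"
  define l where "l = complex_of_real (lead_coeff (\<phi> n))"
  have N: "N \<in> carrier_mat n n" and \<Phi>: "\<Phi> \<in> carrier_vec n" and e: "e \<in> carrier_vec n"
    using H_dim by (auto simp: N_def \<Phi>_def e_def basis_vec_def)
  have a: "a \<in> carrier_vec n"
    unfolding a_def using adj_mat(1)[OF N] e by simp
  have degf: "degree f = n" and lf: "lead_coeff f = l"
    by (simp_all add: f_def l_def deg degree_map_poly coeff_map_poly)
  have d: "degree d = n" "lead_coeff d = 1"
    using degree_monic_char_poly[OF H_dim] by (auto simp: d_def N_def char_poly_def)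
  have d0: "d \<noteq> 0" using d(2) by auto
  have f0: "f \<noteq> 0" using degf n by auto
  have "N = [:0, 1:] \<cdot>\<^sub>m 1\<^sub>m n + - const_mat H"
    using H_dim by (intro eq_matI) (auto simp: N_def char_poly_matrix_def)
  moreover have "[:0, 1:] \<cdot>\<^sub>m 1\<^sub>m n *\<^sub>v \<Phi> = [:0, 1:] \<cdot>\<^sub>v \<Phi>"
    using \<Phi> by (intro eq_vecI) auto
  ultimately have "N *\<^sub>v \<Phi> = [:0, 1:] \<cdot>\<^sub>v \<Phi> + - (const_mat H *\<^sub>v \<Phi>)"
    using H_dim \<Phi> by (simp add: add_mult_distrib_mat_vec[of _ n n])
  also have "\<dots> = Polynomial.smult (inverse (of_real \<chi>)) f \<cdot>\<^sub>v e"
    using \<Phi> e unfolding H[folded \<Phi>_def f_def e_def] by (intro eq_vecI) auto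
  finally have *: "d \<cdot>\<^sub>v \<Phi> = Polynomial.smult (inverse (of_real \<chi>)) f \<cdot>\<^sub>v a"
    unfolding d_def a_def by (rule adj_mat_mult_eq_smult[OF N \<Phi> e])
  have entry: "Polynomial.smult (of_real \<chi>) (d * \<Phi> $ i) = f * a $ i" if "i < n" for i
    using arg_cong[OF *, of "\<lambda>v. Polynomial.smult (of_real \<chi>) (v $ i)"] that \<Phi> a chi by simp
  \<comment> \<open>\<open>\<Phi>\<close> lists the basis by descending degree, so index
    \<open>n - 1\<close> holds the constant \<open>\<phi> 0\<close>.\<close>
  obtain k where k: "\<Phi> $ (n - 1) = [:k:]" "k \<noteq> 0"
  proof -
    obtain k where "\<phi> 0 = [:k:]" using deg[of 0] by (metis degree_eq_zeroE le0)
    then show ?thesis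
      using that[of "of_real k"] n nz by (auto simp: \<Phi>_def basis_vec_def map_poly_pCons)
  qed
  have last: "Polynomial.smult (of_real \<chi> * k) d = f * a $ (n - 1)"
    using entry[of "n - 1"] n k by simp
  moreover have "Polynomial.smult (of_real \<chi> * k) d \<noteq> 0"
    using d0 chi k by simp
  ultimately have "a $ (n - 1) \<noteq> 0" by auto
  \<comment> \<open>Both \<open>d\<close> and \<open>f\<close> have degree \<open>n\<close>, which
    leaves degree 0 for the remaining factor.\<close>
  with arg_cong[OF last, of degree] have "degree (a $ (n - 1)) = 0"
    using f0 chi k degf d by (simp add: degree_mult_eq)
  then obtain m where m: "a $ (n - 1) = [:m:]" by (metis degree_eq_zeroE)
  \<comment> \<open>Leading coefficients are compared: \<open>d\<close> is monic and
    \<open>f\<close> has \<open>l\<close>. This also shows that \<open>m\<close> is nonzero, so that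
    it can be cancelled.\<close>
  have lm: "of_real \<chi> * k = l * m"
    using arg_cong[OF last, of lead_coeff] d(2) lf m chi k by (simp add: lead_coeff_mult)
  then have "m \<noteq> 0" using chi k by auto
  moreover have "Polynomial.smult m (Polynomial.smult l d) = Polynomial.smult m f"
    using last lm m by (simp add: mult.commute)
  ultimately have f: "f = Polynomial.smult l d"
    using smult_cancel by metis
  \<comment> \<open>Substituting \<open>f\<close> into \<open>entry\<close> leaves the nonzero
    factor \<open>d\<close> on both sides.\<close>
  have "Polynomial.smult l (a $ i) = Polynomial.smult (of_real \<chi>) (\<Phi> $ i)" if "i < n" for i
  proof -
    have "d * Polynomial.smult l (a $ i) = d * Polynomial.smult (of_real \<chi>) (\<Phi> $ i)"
      using entry[OF that] by (simp add: f)
    then show ?thesis by (simp only: mult_left_cancel[OF d0])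
  qed
  then show ?thesis
    unfolding \<Phi>_def[symmetric] N_def[symmetric] e_def[symmetric] a_def[symmetric] l_def[symmetric]
    using a \<Phi> by (intro eq_vecI) auto
qed

section \<open>Bilinear expansion and the perturbed adjugate of xI - H\<close>

lemma const_vec_bilinear:
  fixes u u' w w' :: "complex vec"
  assumes "u \<in> carrier_vec n" "u' \<in> carrier_vec n" "w \<in> carrier_vec n" "w' \<in> carrier_vec n"
    and "A \<in> carrier_mat n n" "B \<in> carrier_mat n n"
  shows const_vec_add_left:
      "const_vec (u + u') \<bullet> (A *\<^sub>v const_vec w)
        = const_vec u \<bullet> (A *\<^sub>v const_vec w) + const_vec u' \<bullet> (A *\<^sub>v const_vec w)"
    and const_vec_add_right:
      "const_vec u \<bullet> (A *\<^sub>v const_vec (w + w'))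
        = const_vec u \<bullet> (A *\<^sub>v const_vec w) + const_vec u \<bullet> (A *\<^sub>v const_vec w')"
    and const_vec_mat_diff:
      "const_vec u \<bullet> ((A - B) *\<^sub>v const_vec w)
        = const_vec u \<bullet> (A *\<^sub>v const_vec w) - const_vec u \<bullet> (B *\<^sub>v const_vec w)"
proof -
  have add: "const_vec (x + y) = const_vec x + const_vec y" if "x \<in> carrier_vec n" "y \<in> carrier_vec n"
    for x y
    using that by (intro eq_vecI) auto
  show "const_vec (u + u') \<bullet> (A *\<^sub>v const_vec w)
      = const_vec u \<bullet> (A *\<^sub>v const_vec w) + const_vec u' \<bullet> (A *\<^sub>v const_vec w)"
    using assms by (simp add: add add_scalar_prod_distrib[of _ n])
  show "const_vec u \<bullet> (A *\<^sub>v const_vec (w + w'))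
      = const_vec u \<bullet> (A *\<^sub>v const_vec w) + const_vec u \<bullet> (A *\<^sub>v const_vec w')"
    using assms by (simp add: add mult_add_distrib_mat_vec[of _ n n] scalar_prod_add_distrib[of _ n])
  show "const_vec u \<bullet> ((A - B) *\<^sub>v const_vec w)
      = const_vec u \<bullet> (A *\<^sub>v const_vec w) - const_vec u \<bullet> (B *\<^sub>v const_vec w)"
    using assms by (simp add: minus_mult_distrib_mat_vec[of _ n n] scalar_prod_minus_distrib[of _ n])
qed

text \<open>\<open>L\<close> depends only on \<open>H\<close> and \<open>n\<close>: for
  \<open>\<epsilon> \<le> 1\<close> the entries of both characteristic matrices obey one fixed
  bound, under which the adjugate is Lipschitz.\<close>

lemma poly_l1_adj_char_poly_matrix_diff:
  assumes H: "H \<in> carrier_mat n n"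
  obtains L :: real where "0 \<le> L"
    "\<And>\<epsilon> E i j. E \<in> carrier_mat n n \<Longrightarrow> mat_norm2 E \<le> \<epsilon> \<Longrightarrow> \<epsilon> \<le> 1 \<Longrightarrow> i < n \<Longrightarrow> j < n \<Longrightarrow>
      poly_l1 ((adj_mat (char_poly_matrix (H + E)) - adj_mat (char_poly_matrix H)) $$ (i, j)) \<le> L * \<epsilon>"
proof -
  \<comment> \<open>The 2 consists of 1 for the coefficient of x on the diagonal and 1 for an entry
    of \<open>E\<close>.\<close>
  define b where "b = 2 + (\<Sum>i<n. \<Sum>j<n. cmod (H $$ (i, j)))"
  define L where "L = fact (n - 1) * (real (n - 1) * b ^ (n - 1))"
  have b: "2 + cmod (H $$ (i, j)) \<le> b" if "i < n" "j < n" for i j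
  proof -
    have "cmod (H $$ (i, j)) \<le> (\<Sum>j<n. cmod (H $$ (i, j)))"
      using that by (intro member_le_sum) auto
    also have "\<dots> \<le> (\<Sum>i<n. \<Sum>j<n. cmod (H $$ (i, j)))"
      using that by (intro member_le_sum[where f="\<lambda>i. \<Sum>j<n. cmod (H $$ (i, j))"] sum_nonneg) auto
    finally show ?thesis by (simp add: b_def)
  qed
  have b1: "1 \<le> b"
    by (auto simp: b_def intro!: add_increasing2 sum_nonneg)
  have entry: "poly_l1 (char_poly_matrix A $$ (i, j)) \<le> 1 + cmod (A $$ (i, j))"
    if "A \<in> carrier_mat n n" "i < n" "j < n" for A i j
    using that by (auto simp: char_poly_matrix_def)
  show ?thesis
  proof
    show "0 \<le> L" using b1 by (simp add: L_def)
    fix \<epsilon> :: real and E i j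
    assume E: "E \<in> carrier_mat n n" "mat_norm2 E \<le> \<epsilon>" and \<epsilon>: "\<epsilon> \<le> 1" and ij: "i < n" "j < n"
    have Ent: "cmod (E $$ (k, l)) \<le> \<epsilon>" if "k < n" "l < n" for k l
      using norm_mat_index_le_mat_norm2[OF E(1) that] E(2) by simp
    have "poly_l1 ((adj_mat (char_poly_matrix (H + E)) - adj_mat (char_poly_matrix H)) $$ (i, j))
        \<le> fact (n - 1) * (real (n - 1) * b ^ (n - 1) * \<epsilon>)"
    proof (rule poly_l1_adj_mat_diff[OF _ _ b1])
      fix k l assume kl: "k < n" "l < n"
      show "poly_l1 (char_poly_matrix (H + E) $$ (k, l)) \<le> b"
        using entry[of "H + E" k l] H E kl b[OF kl] Ent[OF kl] \<epsilon>
          norm_triangle_ineq[of "H $$ (k, l)" "E $$ (k, l)"] by auto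
      show "poly_l1 (char_poly_matrix H $$ (k, l)) \<le> b"
        using entry[OF H kl] b[OF kl] by simp
      \<comment> \<open>The diagonal terms in x cancel, leaving a constant polynomial.\<close>
      have "char_poly_matrix (H + E) $$ (k, l) - char_poly_matrix H $$ (k, l) = [:- E $$ (k, l):]"
        using H E kl by (simp add: char_poly_matrix_def)
      then show "poly_l1 (char_poly_matrix (H + E) $$ (k, l) - char_poly_matrix H $$ (k, l)) \<le> \<epsilon>"
        using Ent[OF kl] by simp
    qed (use H E ij in auto)
    then show "poly_l1 ((adj_mat (char_poly_matrix (H + E)) - adj_mat (char_poly_matrix H)) $$ (i, j))
        \<le> L * \<epsilon>"
      by (simp add: L_def mult.assoc)
  qed
qed

section \<open>The first order expansion with a uniform second order constant\<close>

theorem theorem3p1: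
  fixes n :: nat
    and \<phi> :: "nat \<Rightarrow> real poly"
    and \<nu> :: "nat \<Rightarrow> real"
    and \<chi> :: real
    and \<Phi> :: "complex poly vec"
    and e1 c :: "complex vec"
    and H C :: "complex mat"
    and p :: "complex poly"
  assumes n: "n \<ge> 1"
    and deg: "\<And>j. j \<le> n \<Longrightarrow> degree (\<phi> j) = j"
    and nu: "\<And>j. j \<le> n \<Longrightarrow> \<nu> j = lead_coeff (\<phi> j)"
    and nu_nz: "\<And>j. j \<le> n \<Longrightarrow> \<nu> j \<noteq> 0"
    and chi: "\<chi> = \<nu> n * inverse (\<nu> (n - 1))"
    and Phi: "\<Phi> = basis_vec \<phi> n"
    and e1: "e1 = unit_vec n 0"
    and H_dim: "H \<in> carrier_mat n n"
    and H: "const_mat H *\<^sub>v \<Phi> =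
      [:0, 1:] \<cdot>\<^sub>v \<Phi>
      - Polynomial.smult (inverse (of_real \<chi>)) (map_poly of_real (\<phi> n)) \<cdot>\<^sub>v const_vec e1"
    and c: "c \<in> carrier_vec n"
    and C: "C = H - outer_prod e1 c"
    and p: "p = Polynomial.smult (of_real (\<nu> n)) (char_poly C)"
  shows "\<exists>K r :: real. r > 0 \<and>
    (\<forall>\<epsilon>H \<epsilon>c \<epsilon>1 :: real.
      0 \<le> \<epsilon>H \<and> \<epsilon>H < r \<and> 0 \<le> \<epsilon>c \<and> \<epsilon>c < r \<and> 0 \<le> \<epsilon>1 \<and> \<epsilon>1 < r \<and> \<epsilon>H < 1 \<longrightarrow>
      (\<forall>\<delta>H \<in> carrier_mat n n. \<forall>\<delta>c \<in> carrier_vec n. \<forall>\<delta>e1 \<in> carrier_vec n.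
       \<forall>\<delta>C \<in> carrier_mat n n. \<forall>\<delta>p.
        mat_norm2 \<delta>H \<le> \<epsilon>H \<and> vec_norm2 \<delta>c \<le> \<epsilon>c \<and> vec_norm2 \<delta>e1 \<le> \<epsilon>1 \<and>
        C + \<delta>C = H + \<delta>H - outer_prod (e1 + \<delta>e1) (c + \<delta>c) \<and>
        p + \<delta>p = Polynomial.smult (of_real (\<nu> n)) (char_poly (C + \<delta>C)) \<longrightarrow>
        (\<forall>k. cmod (Polynomial.coeff ((p + \<delta>p) -
          (p + Polynomial.smult (of_real (\<nu> n)) (char_poly (H + \<delta>H) - char_poly H)
             + Polynomial.smult (of_real \<chi>) (const_vec \<delta>c \<bullet> \<Phi>)
             + Polynomial.smult (of_real (\<nu> n))
                 (const_vec c \<bullet> (adj_mat (char_poly_matrix H) *\<^sub>v const_vec \<delta>e1))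
             + Polynomial.smult (of_real (\<nu> n))
                 (const_vec c \<bullet>
                   ((adj_mat (char_poly_matrix (H + \<delta>H)) - adj_mat (char_poly_matrix H))
                     *\<^sub>v const_vec e1)))) k)
          \<le> K * (\<epsilon>H\<^sup>2 + \<epsilon>1\<^sup>2 + \<epsilon>c\<^sup>2))))"
proof -
  define N where "N = char_poly_matrix H"
  have N: "N \<in> carrier_mat n n" using H_dim by (simp add: N_def)
  note adjN = adj_mat(1)[OF N]
  have e1_dim: "e1 \<in> carrier_vec n" using e1 by simp
  have Phi_dim: "\<Phi> \<in> carrier_vec n" by (simp add: Phi basis_vec_def)
  have chi_nz: "\<chi> \<noteq> 0" using chi nu_nz[of n] nu_nz[of "n - 1"] by simp
  have col: "[:of_real (\<nu> n):] \<cdot>\<^sub>v (adj_mat N *\<^sub>v const_vec e1) = [:of_real \<chi>:] \<cdot>\<^sub>v \<Phi>"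
    using confederate_adj_first_column[OF n deg _ chi_nz H_dim] H nu[of n] nu[of 0] nu_nz[of 0]
    by (auto simp: N_def Phi e1)
  \<comment> \<open>Written with the unperturbed adjugate, the \<open>\<Phi>\<close> term can be
    compared with its counterpart for \<open>M\<close>.\<close>
  have chi_Phi: "Polynomial.smult (of_real \<chi>) (const_vec w \<bullet> \<Phi>)
      = Polynomial.smult (of_real (\<nu> n)) (const_vec w \<bullet> (adj_mat N *\<^sub>v const_vec e1))"
    if "w \<in> carrier_vec n" for w
    using arg_cong[OF col, of "\<lambda>v. const_vec w \<bullet> v"] that Phi_dim adjN e1_dim
    by simp

  obtain L where L0: "0 \<le> L" and
    L: "\<And>\<epsilon> E i j. E \<in> carrier_mat n n \<Longrightarrow> mat_norm2 E \<le> \<epsilon> \<Longrightarrow> \<epsilon> \<le> 1 \<Longrightarrow> i < n \<Longrightarrow> j < n \<Longrightarrow>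
      poly_l1 ((adj_mat (char_poly_matrix (H + E)) - adj_mat N) $$ (i, j)) \<le> L * \<epsilon>"
    using poly_l1_adj_char_poly_matrix_diff[OF H_dim] unfolding N_def by blast
  define b where "b = (\<Sum>i<n. \<Sum>j<n. poly_l1 (adj_mat N $$ (i, j)))"
  define g where "g = vec_norm2 c"
  \<comment> \<open>The summands \<open>L\<close>, \<open>g * L\<close> and \<open>b + L\<close>
    belong to the three error terms: \<open>\<delta>c\<close> against \<open>e1\<close>,
    \<open>c\<close> against \<open>\<delta>e1\<close>, and \<open>\<delta>c\<close> against
    \<open>\<delta>e1\<close>. The square of \<open>n\<close> counts the terms of each bilinear
    form.\<close>
  define K where "K = cmod (of_real (\<nu> n)) * ((real n)\<^sup>2 * (L + g * L + (b + L)))"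
  have b: "poly_l1 (adj_mat N $$ (i, j)) \<le> b" if "i < n" "j < n" for i j
  proof -
    have "poly_l1 (adj_mat N $$ (i, j)) \<le> (\<Sum>j<n. poly_l1 (adj_mat N $$ (i, j)))"
      using that by (intro member_le_sum) auto
    also have "\<dots> \<le> b"
      unfolding b_def using that
      by (intro member_le_sum[where f="\<lambda>i. \<Sum>j<n. poly_l1 (adj_mat N $$ (i, j))"] sum_nonneg) auto
    finally show ?thesis .
  qed
  have b0: "0 \<le> b" by (auto simp: b_def intro!: sum_nonneg)
  have g0: "0 \<le> g" by (simp add: g_def vec_norm2_def)

  have bound: "cmod (Polynomial.coeff ((p + \<delta>p) -
          (p + Polynomial.smult (of_real (\<nu> n)) (char_poly (H + \<delta>H) - char_poly H)
             + Polynomial.smult (of_real \<chi>) (const_vec \<delta>c \<bullet> \<Phi>)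
             + Polynomial.smult (of_real (\<nu> n))
                 (const_vec c \<bullet> (adj_mat (char_poly_matrix H) *\<^sub>v const_vec \<delta>e1))
             + Polynomial.smult (of_real (\<nu> n))
                 (const_vec c \<bullet>
                   ((adj_mat (char_poly_matrix (H + \<delta>H)) - adj_mat (char_poly_matrix H))
                     *\<^sub>v const_vec e1)))) k)
          \<le> K * (\<epsilon>H\<^sup>2 + \<epsilon>1\<^sup>2 + \<epsilon>c\<^sup>2)"
    if eps: "0 \<le> \<epsilon>H" "\<epsilon>H < 1" "0 \<le> \<epsilon>c" "0 \<le> \<epsilon>1"
      and dH: "\<delta>H \<in> carrier_mat n n" "mat_norm2 \<delta>H \<le> \<epsilon>H"
      and dc: "\<delta>c \<in> carrier_vec n" "vec_norm2 \<delta>c \<le> \<epsilon>c"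
      and de: "\<delta>e1 \<in> carrier_vec n" "vec_norm2 \<delta>e1 \<le> \<epsilon>1"
      and CdC: "C + \<delta>C = H + \<delta>H - outer_prod (e1 + \<delta>e1) (c + \<delta>c)"
      and pdp: "p + \<delta>p = Polynomial.smult (of_real (\<nu> n)) (char_poly (C + \<delta>C))"
    for \<epsilon>H \<epsilon>c \<epsilon>1 :: real and \<delta>H \<delta>c \<delta>e1 \<delta>C \<delta>p k
  proof -
    define M where "M = char_poly_matrix (H + \<delta>H)"
    have HdH: "H + \<delta>H \<in> carrier_mat n n" using H_dim dH by simp
    then have M: "M \<in> carrier_mat n n" by (simp add: M_def)
    note adjM = adj_mat(1)[OF M]
    have diff: "adj_mat M - adj_mat N \<in> carrier_mat n n" by (rule minus_carrier_mat[OF adjN])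
    note dims = c dc(1) e1_dim de(1) adjM adjN
    let ?R = "const_vec \<delta>c \<bullet> ((adj_mat M - adj_mat N) *\<^sub>v const_vec e1)
      + const_vec c \<bullet> ((adj_mat M - adj_mat N) *\<^sub>v const_vec \<delta>e1)
      + const_vec \<delta>c \<bullet> (adj_mat M *\<^sub>v const_vec \<delta>e1)"
    have p_eq: "p = Polynomial.smult (of_real (\<nu> n))
        (char_poly H + const_vec c \<bullet> (adj_mat N *\<^sub>v const_vec e1))"
      unfolding p C N_def using char_poly_diff_outer_prod[OF H_dim e1_dim c] by simp
    have pdp_eq: "p + \<delta>p = Polynomial.smult (of_real (\<nu> n))
        (char_poly (H + \<delta>H) + const_vec (c + \<delta>c) \<bullet> (adj_mat M *\<^sub>v const_vec (e1 + \<delta>e1)))"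
      unfolding pdp CdC M_def using char_poly_diff_outer_prod[OF HdH, of "e1 + \<delta>e1" "c + \<delta>c"] dims
      by simp
    have expand: "const_vec (c + \<delta>c) \<bullet> (adj_mat M *\<^sub>v const_vec (e1 + \<delta>e1))
        = const_vec c \<bullet> (adj_mat M *\<^sub>v const_vec e1) + const_vec c \<bullet> (adj_mat M *\<^sub>v const_vec \<delta>e1)
        + const_vec \<delta>c \<bullet> (adj_mat M *\<^sub>v const_vec e1) + const_vec \<delta>c \<bullet> (adj_mat M *\<^sub>v const_vec \<delta>e1)"
      using dims by (simp add: const_vec_add_left[of _ n] const_vec_add_right[of _ n])
    have "(p + \<delta>p) -
          (p + Polynomial.smult (of_real (\<nu> n)) (char_poly (H + \<delta>H) - char_poly H)
             + Polynomial.smult (of_real \<chi>) (const_vec \<delta>c \<bullet> \<Phi>)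
             + Polynomial.smult (of_real (\<nu> n)) (const_vec c \<bullet> (adj_mat N *\<^sub>v const_vec \<delta>e1))
             + Polynomial.smult (of_real (\<nu> n))
                 (const_vec c \<bullet> ((adj_mat M - adj_mat N) *\<^sub>v const_vec e1)))
        = Polynomial.smult (of_real (\<nu> n)) ?R"
      \<comment> \<open>\<open>p + \<delta>p\<close> has to be rewritten as a whole before
        \<open>p_eq\<close> replaces the remaining \<open>p\<close>.\<close>
      unfolding pdp_eq expand chi_Phi[OF dc(1)]
      unfolding p_eq const_vec_mat_diff[OF c c e1_dim e1_dim adjM adjN]
        const_vec_mat_diff[OF c c de(1) de(1) adjM adjN]
        const_vec_mat_diff[OF dc(1) dc(1) e1_dim e1_dim adjM adjN]
      by (simp add: smult_add_right smult_diff_right)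
    then have "cmod (Polynomial.coeff ((p + \<delta>p) -
          (p + Polynomial.smult (of_real (\<nu> n)) (char_poly (H + \<delta>H) - char_poly H)
             + Polynomial.smult (of_real \<chi>) (const_vec \<delta>c \<bullet> \<Phi>)
             + Polynomial.smult (of_real (\<nu> n)) (const_vec c \<bullet> (adj_mat N *\<^sub>v const_vec \<delta>e1))
             + Polynomial.smult (of_real (\<nu> n))
                 (const_vec c \<bullet> ((adj_mat M - adj_mat N) *\<^sub>v const_vec e1)))) k)
        \<le> cmod (of_real (\<nu> n)) * poly_l1 ?R"
      using norm_coeff_le_poly_l1[of "Polynomial.smult (of_real (\<nu> n)) ?R" k] by (simp only: poly_l1_smult)
    also have "\<dots> \<le> K * (\<epsilon>H\<^sup>2 + \<epsilon>1\<^sup>2 + \<epsilon>c\<^sup>2)"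
    proof -
      let ?q = "\<epsilon>H\<^sup>2 + \<epsilon>1\<^sup>2 + \<epsilon>c\<^sup>2"
      have dc_le: "cmod (\<delta>c $ i) \<le> \<epsilon>c" if "i < n" for i
        using norm_vec_index_le_vec_norm2[of i \<delta>c] dc that by auto
      have de_le: "cmod (\<delta>e1 $ i) \<le> \<epsilon>1" if "i < n" for i
        using norm_vec_index_le_vec_norm2[of i \<delta>e1] de that by auto
      have c_le: "cmod (c $ i) \<le> g" if "i < n" for i
        using norm_vec_index_le_vec_norm2[of i c] c that by (auto simp: g_def)
      have e_le: "cmod (e1 $ i) \<le> 1" if "i < n" for i
        using that n by (simp add: e1)
      have diff_le: "poly_l1 ((adj_mat M - adj_mat N) $$ (i, j)) \<le> L * \<epsilon>H" if "i < n" "j < n" for i j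
        using L[OF dH _ that] eps by (simp add: M_def)
      have M_le: "poly_l1 (adj_mat M $$ (i, j)) \<le> b + L" if "i < n" "j < n" for i j
      proof -
        \<comment> \<open>With \<open>\<epsilon>H < 1\<close> the perturbed adjugate stays within
          \<open>L\<close> of the unperturbed one, whose entries are bounded by
          \<open>b\<close>.\<close>
        have "L * \<epsilon>H \<le> L" using L0 eps by (simp add: mult_left_le)
        then show ?thesis
          using poly_l1_triangle[of "adj_mat N $$ (i, j)" "(adj_mat M - adj_mat N) $$ (i, j)"]
            diff_le[OF that] b[OF that] that adjM adjN by simp
      qed
      \<comment> \<open>From 2xy \<le> x^2 + y^2, with xy \<le> 2xy for nonnegative x and y.\<close>
      have cH: "\<epsilon>c * \<epsilon>H \<le> ?q" and H1: "\<epsilon>H * \<epsilon>1 \<le> ?q" and c1: "\<epsilon>c * \<epsilon>1 \<le> ?q"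
        using sum_squares_bound[of \<epsilon>c \<epsilon>H] sum_squares_bound[of \<epsilon>H \<epsilon>1] sum_squares_bound[of \<epsilon>c \<epsilon>1]
          mult_nonneg_nonneg[OF eps(3,1)] mult_nonneg_nonneg[OF eps(1,4)] mult_nonneg_nonneg[OF eps(3,4)]
          zero_le_power2[of \<epsilon>c] zero_le_power2[of \<epsilon>H] zero_le_power2[of \<epsilon>1]
        by linarith+
      have "poly_l1 ?R \<le> (real n)\<^sup>2 * (\<epsilon>c * (L * \<epsilon>H) * 1) + (real n)\<^sup>2 * (g * (L * \<epsilon>H) * \<epsilon>1)
          + (real n)\<^sup>2 * (\<epsilon>c * (b + L) * \<epsilon>1)"
        by (intro order_trans[OF poly_l1_triangle] add_mono poly_l1_bilinear_le dims diff
            dc_le de_le c_le e_le diff_le M_le)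
      also have "\<dots> = (real n)\<^sup>2 * (L * (\<epsilon>c * \<epsilon>H) + g * L * (\<epsilon>H * \<epsilon>1) + (b + L) * (\<epsilon>c * \<epsilon>1))"
        by (simp add: algebra_simps)
      also have "\<dots> \<le> (real n)\<^sup>2 * (L * ?q + g * L * ?q + (b + L) * ?q)"
        using L0 b0 g0 by (intro mult_left_mono add_mono cH H1 c1) auto
      also have "\<dots> = (real n)\<^sup>2 * (L + g * L + (b + L)) * ?q"
        by (simp add: algebra_simps)
      finally show ?thesis
        unfolding K_def mult.assoc by (rule mult_left_mono) simp
    qed
    finally show ?thesis unfolding M_def N_def .
  qed
  \<comment> \<open>The estimate already holds on the whole range up to 1, so \<open>r\<close> is
    1.\<close>
  show ?thesis
    by (intro exI[of _ K] exI[of _ 1] conjI allI ballI impI, simp, elim conjE, rule bound; assumption)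
qed

end
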